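(* Let $X$ be a bounded lattice. Then there exists an abelian group $M(X)$ representing the functor $\mathcal{M}(X,-)$ from abelian groups to abelian groups, i.e. there is a natural isomorphism \[ \operatorname{Hom}_{\mathbb{Z}}(M(X),-)\cong\mathcal{M}(X,-). \]
   Context: A bounded lattice $X$ has a least element $0_X$ and a greatest element $1_X$. For an abelian group $B$, a ($B$-valued) measure on $X$ is a function $\nu:X\to B$ with $\nu(0_X)=0$ and, for all $k\ge 2$ and all $x_1,\dots,x_k\in X$, \[ \nu(x_1\vee\dots\vee x_k)=\sum_{s=1}^k(-1)^{s+1}\sum_{1\leq i_1<\dots<i_s\leq k}\nu(x_{i_1}\wedge\dots\wedge x_{i_s}). \] $\mathcal{M}(X,B)$ is the abelian group of all $B$-valued measures on $X$; a homomorphism $f:B\to B'$ acts by $\nu\mapsto f\circ\nu$. *)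

theory Defs
  imports "HOL-Algebra.Lattice" "HOL-Algebra.Generated_Groups" "HOL-Algebra.Free_Abelian_Groups"
begin

text \<open>
  Abelian groups are \<open>comm_group\<close> structures, hence written multiplicatively: the integer
  multiple \<open>n \<cdot> b\<close> is \<open>b [^] n\<close> and a finite sum is \<open>finprod\<close>. Morphisms and measures are
  extensional, i.e. \<open>undefined\<close> off the carrier of their domain, so that equality of functions
  is equality on the carrier.
\<close>

text \<open>A tuple \<open>i\<^sub>1 < \<dots> < i\<^sub>s\<close> in \<open>{1..k}\<close> is the same thing as an \<open>s\<close>-element subset \<open>I\<close>.\<close>

definition is_measure ::
  "('a, 'c) gorder_scheme \<Rightarrow> ('b, 'd) monoid_scheme \<Rightarrow> ('a \<Rightarrow> 'b) \<Rightarrow> bool" where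
  "is_measure L B \<nu> \<longleftrightarrow>
     \<nu> \<in> carrier L \<rightarrow>\<^sub>E carrier B \<and>
     \<nu> \<bottom>\<^bsub>L\<^esub> = \<one>\<^bsub>B\<^esub> \<and>
     (\<forall>k\<ge>2. \<forall>x \<in> {1..k} \<rightarrow> carrier L.
        \<nu> (\<Squnion>\<^bsub>L\<^esub> (x ` {1..k})) =
        finprod B (\<lambda>s.
            finprod B (\<lambda>I. \<nu> (\<Sqinter>\<^bsub>L\<^esub> (x ` I))) {I. I \<subseteq> {1..k} \<and> card I = s}
              [^]\<^bsub>B\<^esub> ((-1 :: int) ^ (s + 1)))
          {1..k::nat})"

definition measure_group ::
  "('a, 'c) gorder_scheme \<Rightarrow> ('b, 'd) monoid_scheme \<Rightarrow> ('a \<Rightarrow> 'b) monoid" where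
  "measure_group L B =
     \<lparr>carrier = {\<nu>. is_measure L B \<nu>},
      monoid.mult = (\<lambda>\<mu> \<nu>. \<lambda>x\<in>carrier L. \<mu> x \<otimes>\<^bsub>B\<^esub> \<nu> x),
      one = (\<lambda>x\<in>carrier L. \<one>\<^bsub>B\<^esub>)\<rparr>"

definition measure_map :: "('a, 'c) gorder_scheme \<Rightarrow> ('b \<Rightarrow> 'e) \<Rightarrow> ('a \<Rightarrow> 'b) \<Rightarrow> ('a \<Rightarrow> 'e)" where
  "measure_map L f \<nu> = compose (carrier L) f \<nu>"

definition Hom_group ::
  "('a, 'c) monoid_scheme \<Rightarrow> ('b, 'd) monoid_scheme \<Rightarrow> ('a \<Rightarrow> 'b) monoid" where
  "Hom_group A B =
     \<lparr>carrier = hom A B \<inter> extensional (carrier A),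
      monoid.mult = (\<lambda>g h. \<lambda>a\<in>carrier A. g a \<otimes>\<^bsub>B\<^esub> h a),
      one = (\<lambda>a\<in>carrier A. \<one>\<^bsub>B\<^esub>)\<rparr>"

definition Hom_map :: "('a, 'c) monoid_scheme \<Rightarrow> ('b \<Rightarrow> 'e) \<Rightarrow> ('a \<Rightarrow> 'b) \<Rightarrow> ('a \<Rightarrow> 'e)" where
  "Hom_map A f h = compose (carrier A) f h"

text \<open>
  HOL cannot quantify over types inside a formula, so ``there is a group such that for all
  abelian groups \<open>B\<close>'' cannot be an existential formula without letting the witness depend on the
  type of \<open>B\<close>. The representing group is therefore given by a term whose type depends on \<open>L\<close> only
  (the free abelian group on \<open>L\<close> modulo the measure relations), and the natural transformation by
  a term polymorphic in the type of \<open>B\<close>.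
\<close>

definition measure_relations :: "('a, 'c) gorder_scheme \<Rightarrow> ('a \<Rightarrow>\<^sub>0 int) set" where
  "measure_relations L =
     {frag_of \<bottom>\<^bsub>L\<^esub>} \<union>
     {frag_of (\<Squnion>\<^bsub>L\<^esub> (x ` {1..k})) -
        (\<Sum>s = 1..k. frag_cmul ((-1) ^ (s + 1))
           (\<Sum>I | I \<subseteq> {1..k} \<and> card I = s. frag_of (\<Sqinter>\<^bsub>L\<^esub> (x ` I))))
      | (k::nat) x. 2 \<le> k \<and> x \<in> {1..k} \<rightarrow> carrier L}"

definition relation_subgroup :: "('a, 'c) gorder_scheme \<Rightarrow> ('a \<Rightarrow>\<^sub>0 int) set" where
  "relation_subgroup L = generate (free_Abelian_group (carrier L)) (measure_relations L)"

definition universal_group :: "('a, 'c) gorder_scheme \<Rightarrow> ('a \<Rightarrow>\<^sub>0 int) set monoid" where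
  "universal_group L = free_Abelian_group (carrier L) Mod relation_subgroup L"

definition universal_measure :: "('a, 'c) gorder_scheme \<Rightarrow> 'a \<Rightarrow> ('a \<Rightarrow>\<^sub>0 int) set" where
  "universal_measure L =
     (\<lambda>x\<in>carrier L. relation_subgroup L #>\<^bsub>free_Abelian_group (carrier L)\<^esub> frag_of x)"

definition representation ::
  "('a, 'c) gorder_scheme \<Rightarrow> (('a \<Rightarrow>\<^sub>0 int) set \<Rightarrow> 'b) \<Rightarrow> ('a \<Rightarrow> 'b)" where
  "representation L h = compose (carrier L) h (universal_measure L)"

text \<open>\<open>Hom_group A\<close> and \<open>measure_group L\<close> are functors from abelian groups to abelian groups.\<close>

lemma comm_group_Hom_group:
  assumes "group A" "comm_group B"
  shows "comm_group (Hom_group A B)"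
proof -
  interpret A: group A by fact
  interpret B: comm_group B by fact
  show ?thesis
  proof (rule comm_groupI)
    fix g h assume "g \<in> carrier (Hom_group A B)" "h \<in> carrier (Hom_group A B)"
    then show "g \<otimes>\<^bsub>Hom_group A B\<^esub> h \<in> carrier (Hom_group A B)"
      by (auto simp: Hom_group_def hom_def Pi_iff B.m_ac)
  next
    fix g assume g: "g \<in> carrier (Hom_group A B)"
    show "\<exists>h\<in>carrier (Hom_group A B). h \<otimes>\<^bsub>Hom_group A B\<^esub> g = \<one>\<^bsub>Hom_group A B\<^esub>"
    proof (rule bexI[where x = "\<lambda>a\<in>carrier A. inv\<^bsub>B\<^esub> g a"])
      show "(\<lambda>a\<in>carrier A. inv\<^bsub>B\<^esub> g a) \<otimes>\<^bsub>Hom_group A B\<^esub> g = \<one>\<^bsub>Hom_group A B\<^esub>"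
        using g by (auto simp: Hom_group_def hom_def Pi_iff)
      show "(\<lambda>a\<in>carrier A. inv\<^bsub>B\<^esub> g a) \<in> carrier (Hom_group A B)"
        using g by (auto simp: Hom_group_def hom_def Pi_iff B.inv_mult)
    qed
  qed (auto simp: Hom_group_def hom_def Pi_iff B.m_ac extensional_def fun_eq_iff)
qed

lemma finprod_hom:
  assumes "comm_group B" "comm_group B'" "f \<in> hom B B'" "finite I" "u \<in> I \<rightarrow> carrier B"
  shows "f (finprod B u I) = finprod B' (\<lambda>i. f (u i)) I"
proof -
  interpret B: comm_group B by fact
  interpret B': comm_group B' by fact
  interpret f: group_hom B B' f by unfold_locales fact
  from assms(4,5) show ?thesis
    by (induction I rule: finite_induct)
      (auto simp: f.hom_mult B.finprod_insert Pi_iff B'.finprod_insert B.finprod_closed)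
qed

definition incl_excl ::
  "('a, 'c) gorder_scheme \<Rightarrow> ('b, 'd) monoid_scheme \<Rightarrow> nat \<Rightarrow> (nat \<Rightarrow> 'a) \<Rightarrow> ('a \<Rightarrow> 'b) \<Rightarrow> 'b" where
  "incl_excl L B k x \<nu> =
     finprod B (\<lambda>s.
         finprod B (\<lambda>I. \<nu> (\<Sqinter>\<^bsub>L\<^esub> (x ` I))) {I. I \<subseteq> {1..k} \<and> card I = s}
           [^]\<^bsub>B\<^esub> ((-1 :: int) ^ (s + 1)))
       {1..k}"

lemma is_measure_iff:
  "is_measure L B \<nu> \<longleftrightarrow>
     \<nu> \<in> carrier L \<rightarrow>\<^sub>E carrier B \<and> \<nu> \<bottom>\<^bsub>L\<^esub> = \<one>\<^bsub>B\<^esub> \<and>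
     (\<forall>k\<ge>2. \<forall>x \<in> {1..k} \<rightarrow> carrier L. \<nu> (\<Squnion>\<^bsub>L\<^esub> (x ` {1..k})) = incl_excl L B k x \<nu>)"
  by (simp add: is_measure_def incl_excl_def)

lemma Inf_closed:
  assumes "bounded_lattice L" "x \<in> {1..k::nat} \<rightarrow> carrier L" "I \<subseteq> {1..k}" "I \<noteq> {}"
  shows "\<Sqinter>\<^bsub>L\<^esub> (x ` I) \<in> carrier L"
proof -
  interpret L: bounded_lattice L by fact
  show ?thesis
    using assms by (intro L.finite_inf_closed) (auto intro: finite_subset)
qed

lemma Sup_closed:
  assumes "bounded_lattice L" "x \<in> {1..k::nat} \<rightarrow> carrier L" "2 \<le> k"
  shows "\<Squnion>\<^bsub>L\<^esub> (x ` {1..k}) \<in> carrier L"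
proof -
  interpret L: bounded_lattice L by fact
  show ?thesis
    using assms by (intro L.finite_sup_closed) auto
qed

lemma incl_excl_hom:
  assumes L: "bounded_lattice L" and B: "comm_group B" and B': "comm_group B'"
    and f: "f \<in> hom B B'" and \<nu>: "\<nu> \<in> carrier L \<rightarrow> carrier B"
    and x: "x \<in> {1..k} \<rightarrow> carrier L"
    and \<nu>': "\<And>y. y \<in> carrier L \<Longrightarrow> \<nu>' y = f (\<nu> y)"
  shows "incl_excl L B' k x \<nu>' = f (incl_excl L B k x \<nu>)"
proof -
  interpret B: comm_group B by fact
  interpret B': comm_group B' by fact
  interpret f: group_hom B B' f by unfold_locales fact
  have cl: "\<Sqinter>\<^bsub>L\<^esub> (x ` I) \<in> carrier L" if "s \<in> {1..k}" "I \<subseteq> {1..k}" "card I = s" for s I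
    using that by (intro Inf_closed[OF L x]) auto
  have inner: "(\<lambda>I. \<nu> (\<Sqinter>\<^bsub>L\<^esub> (x ` I))) \<in> {I. I \<subseteq> {1..k} \<and> card I = s} \<rightarrow> carrier B"
    if "s \<in> {1..k}" for s using cl[OF that] \<nu> by auto
  have "finprod B' (\<lambda>I. \<nu>' (\<Sqinter>\<^bsub>L\<^esub> (x ` I))) {I. I \<subseteq> {1..k} \<and> card I = s} =
        f (finprod B (\<lambda>I. \<nu> (\<Sqinter>\<^bsub>L\<^esub> (x ` I))) {I. I \<subseteq> {1..k} \<and> card I = s})"
    if s: "s \<in> {1..k}" for s
  proof -
    have "f (finprod B (\<lambda>I. \<nu> (\<Sqinter>\<^bsub>L\<^esub> (x ` I))) {I. I \<subseteq> {1..k} \<and> card I = s}) =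
          finprod B' (\<lambda>I. f (\<nu> (\<Sqinter>\<^bsub>L\<^esub> (x ` I)))) {I. I \<subseteq> {1..k} \<and> card I = s}"
      by (rule finprod_hom[OF B B' f _ inner[OF s]]) simp
    also have "\<dots> = finprod B' (\<lambda>I. \<nu>' (\<Sqinter>\<^bsub>L\<^esub> (x ` I))) {I. I \<subseteq> {1..k} \<and> card I = s}"
      using cl[OF s] \<nu> by (intro B'.finprod_cong') (auto simp: \<nu>' intro!: f.hom_closed)
    finally show ?thesis by simp
  qed
  note 1 = this
  have cl2: "finprod B (\<lambda>I. \<nu> (\<Sqinter>\<^bsub>L\<^esub> (x ` I))) {I. I \<subseteq> {1..k} \<and> card I = s} \<in> carrier B"
    if "s \<in> {1..k}" for s by (rule B.finprod_closed[OF inner[OF that]])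
  have pow: "f (b [^]\<^bsub>B\<^esub> n) = f b [^]\<^bsub>B'\<^esub> n" if "b \<in> carrier B" for b and n :: int
    using that by (rule f.hom_int_pow)
  show ?thesis
    unfolding incl_excl_def
    by (subst finprod_hom[OF B B' f])
      (auto intro!: B'.finprod_cong' B.int_pow_closed B'.int_pow_closed f.hom_closed cl2
        simp: 1[simplified] cl2[simplified] pow)
qed

lemma measure_map_closed:
  assumes L: "bounded_lattice L" and B: "comm_group B" and B': "comm_group B'"
    and f: "f \<in> hom B B'" and \<nu>: "is_measure L B \<nu>"
  shows "is_measure L B' (measure_map L f \<nu>)"
proof -
  interpret L: bounded_lattice L by fact
  interpret f: group_hom B B' f
    using B B' f by (simp add: group_hom_def group_hom_axioms_def comm_group.axioms)
  have \<nu>': "\<nu> \<in> carrier L \<rightarrow> carrier B" using \<nu> by (auto simp: is_measure_iff)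
  show ?thesis
    unfolding is_measure_iff
  proof (intro conjI allI impI ballI)
    show "measure_map L f \<nu> \<in> carrier L \<rightarrow>\<^sub>E carrier B'"
      using \<nu>' by (auto simp: measure_map_def compose_def intro!: f.hom_closed)
    show "measure_map L f \<nu> \<bottom>\<^bsub>L\<^esub> = \<one>\<^bsub>B'\<^esub>"
      using \<nu> by (simp add: is_measure_iff measure_map_def compose_def)
    fix k :: nat and x assume k: "2 \<le> k" and x: "x \<in> {1..k} \<rightarrow> carrier L"
    have "incl_excl L B' k x (measure_map L f \<nu>) = f (incl_excl L B k x \<nu>)"
      by (rule incl_excl_hom[OF L B B' f \<nu>' x]) (simp add: measure_map_def compose_def)
    moreover have "incl_excl L B k x \<nu> = \<nu> (\<Squnion>\<^bsub>L\<^esub> (x ` {1..k}))"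
      using \<nu> k x by (simp add: is_measure_iff)
    ultimately show "measure_map L f \<nu> (\<Squnion>\<^bsub>L\<^esub> (x ` {1..k})) =
        incl_excl L B' k x (measure_map L f \<nu>)"
      using Sup_closed[OF L x k] by (simp add: measure_map_def compose_def)
  qed
qed

lemma is_measure_one:
  assumes L: "bounded_lattice L" and B: "comm_group B"
  shows "is_measure L B (\<lambda>x\<in>carrier L. \<one>\<^bsub>B\<^esub>)"
proof -
  interpret L: bounded_lattice L by fact
  interpret B: comm_group B by fact
  have "incl_excl L B k x (\<lambda>x\<in>carrier L. \<one>\<^bsub>B\<^esub>) = \<one>\<^bsub>B\<^esub>"
    if "x \<in> {1..k} \<rightarrow> carrier L" for k x
    by (rule incl_excl_hom[OF L B B, where f = "\<lambda>_. \<one>\<^bsub>B\<^esub>" and \<nu> = "\<lambda>_. \<one>\<^bsub>B\<^esub>"])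
      (use that in \<open>auto simp: hom_def\<close>)
  then show ?thesis
    using Sup_closed[OF L] by (auto simp: is_measure_iff)
qed

lemma is_measure_mult:
  assumes L: "bounded_lattice L" and B: "comm_group B"
    and \<mu>: "is_measure L B \<mu>" and \<nu>: "is_measure L B \<nu>"
  shows "is_measure L B (\<lambda>x\<in>carrier L. \<mu> x \<otimes>\<^bsub>B\<^esub> \<nu> x)"
proof -
  interpret L: bounded_lattice L by fact
  interpret B: comm_group B by fact
  have BB: "comm_group (B \<times>\<times> B)"
    by (intro group.group_comm_groupI DirProd_group B.group_axioms) (auto simp: DirProd_def B.m_ac)
  let ?p = "\<lambda>x. (\<mu> x, \<nu> x)"
  have cl: "\<mu> x \<in> carrier B" "\<nu> x \<in> carrier B" if "x \<in> carrier L" for x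
    using \<mu> \<nu> that by (auto simp: is_measure_iff)
  have p: "?p \<in> carrier L \<rightarrow> carrier (B \<times>\<times> B)"
    using cl by (auto simp: DirProd_def)
  have hm: "(\<lambda>z. fst z \<otimes>\<^bsub>B\<^esub> snd z) \<in> hom (B \<times>\<times> B) B"
    by (auto simp: hom_def DirProd_def B.m_ac)
  have h1: "fst \<in> hom (B \<times>\<times> B) B" "snd \<in> hom (B \<times>\<times> B) B"
    by (auto simp: hom_def DirProd_def)
  have "incl_excl L B k x (\<lambda>x\<in>carrier L. \<mu> x \<otimes>\<^bsub>B\<^esub> \<nu> x) =
        incl_excl L B k x \<mu> \<otimes>\<^bsub>B\<^esub> incl_excl L B k x \<nu>"
    if x: "x \<in> {1..k} \<rightarrow> carrier L" for k x
  proof -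
    have "incl_excl L B k x (\<lambda>x\<in>carrier L. \<mu> x \<otimes>\<^bsub>B\<^esub> \<nu> x) =
          fst (incl_excl L (B \<times>\<times> B) k x ?p) \<otimes>\<^bsub>B\<^esub> snd (incl_excl L (B \<times>\<times> B) k x ?p)"
      by (rule incl_excl_hom[OF L BB B hm p x]) simp
    moreover have "incl_excl L B k x \<mu> = fst (incl_excl L (B \<times>\<times> B) k x ?p)"
      by (rule incl_excl_hom[OF L BB B h1(1) p x]) simp
    moreover have "incl_excl L B k x \<nu> = snd (incl_excl L (B \<times>\<times> B) k x ?p)"
      by (rule incl_excl_hom[OF L BB B h1(2) p x]) simp
    ultimately show ?thesis by simp
  qed
  moreover have "(\<lambda>x\<in>carrier L. \<mu> x \<otimes>\<^bsub>B\<^esub> \<nu> x) \<in> carrier L \<rightarrow>\<^sub>E carrier B"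
    using cl by auto
  ultimately show ?thesis
    using \<mu> \<nu> Sup_closed[OF L] by (simp add: is_measure_iff)
qed

lemma comm_group_measure_group:
  assumes L: "bounded_lattice L" and B: "comm_group B"
  shows "comm_group (measure_group L B)"
proof -
  interpret B: comm_group B by fact
  have cl: "\<nu> x \<in> carrier B" if "is_measure L B \<nu>" "x \<in> carrier L" for \<nu> x
    using that by (auto simp: is_measure_iff)
  have ext: "\<nu> \<in> extensional (carrier L)" if "is_measure L B \<nu>" for \<nu>
    using that by (auto simp: is_measure_iff PiE_def)
  show ?thesis
  proof (rule comm_groupI)
    fix \<nu> assume "\<nu> \<in> carrier (measure_group L B)"
    then have \<nu>: "is_measure L B \<nu>" by (simp add: measure_group_def)
    have "m_inv B \<in> hom B B" by (auto simp: hom_def B.inv_mult)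
    from measure_map_closed[OF L B B this \<nu>]
    show "\<exists>\<mu>\<in>carrier (measure_group L B). \<mu> \<otimes>\<^bsub>measure_group L B\<^esub> \<nu> = \<one>\<^bsub>measure_group L B\<^esub>"
      using cl[OF \<nu>]
      by (intro bexI[of _ "measure_map L (m_inv B) \<nu>"])
        (auto simp: measure_group_def measure_map_def compose_def)
  next
    fix \<nu> assume "\<nu> \<in> carrier (measure_group L B)"
    then have \<nu>: "is_measure L B \<nu>" by (simp add: measure_group_def)
    show "\<one>\<^bsub>measure_group L B\<^esub> \<otimes>\<^bsub>measure_group L B\<^esub> \<nu> = \<nu>"
      using cl[OF \<nu>] ext[OF \<nu>]
      by (auto simp: measure_group_def fun_eq_iff extensional_def)
  qed (auto simp: measure_group_def is_measure_one[OF L B] is_measure_mult[OF L B] cl B.m_ac)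
qed

lemma measure_map_hom:
  assumes "bounded_lattice L" "comm_group B" "comm_group B'" "f \<in> hom B B'"
  shows "measure_map L f \<in> hom (measure_group L B) (measure_group L B')"
proof (rule homI)
  fix \<mu> \<nu> assume "\<mu> \<in> carrier (measure_group L B)" "\<nu> \<in> carrier (measure_group L B)"
  then have "\<mu> x \<in> carrier B \<and> \<nu> x \<in> carrier B" if "x \<in> carrier L" for x
    using that by (auto simp: measure_group_def is_measure_iff)
  then show "measure_map L f (\<mu> \<otimes>\<^bsub>measure_group L B\<^esub> \<nu>) =
      measure_map L f \<mu> \<otimes>\<^bsub>measure_group L B'\<^esub> measure_map L f \<nu>"
    using assms(4) by (auto simp: measure_group_def measure_map_def compose_def hom_def)
qed (use measure_map_closed[OF assms] in \<open>simp add: measure_group_def\<close>)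

lemma Hom_map_hom:
  assumes "group A" "f \<in> hom B B'"
  shows "Hom_map A f \<in> hom (Hom_group A B) (Hom_group A B')"
proof -
  interpret A: group A by fact
  show ?thesis
    using assms(2) by (auto simp: Hom_group_def Hom_map_def compose_def hom_def Pi_iff)
qed

lemma measure_map_id: "is_measure L B \<nu> \<Longrightarrow> measure_map L (\<lambda>b. b) \<nu> = \<nu>"
  by (auto simp: measure_map_def compose_def is_measure_iff PiE_def extensional_def fun_eq_iff)

lemma measure_map_comp: "measure_map L (g \<circ> f) \<nu> = measure_map L g (measure_map L f \<nu>)"
  by (auto simp: measure_map_def compose_def)

lemma Hom_map_id: "h \<in> carrier (Hom_group A B) \<Longrightarrow> Hom_map A (\<lambda>b. b) h = h"
  by (auto simp: Hom_map_def Hom_group_def compose_def extensional_def fun_eq_iff)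

lemma Hom_map_comp: "Hom_map A (g \<circ> f) h = Hom_map A g (Hom_map A f h)"
  by (auto simp: Hom_map_def compose_def)

end

theory Submission
  imports Defs
begin

text \<open>
  Homomorphisms out of the free abelian group \<open>F\<close> on \<open>L\<close> are arbitrary functions on \<open>L\<close>, and such a
  function is a measure exactly when the homomorphism kills the measure relations, i.e. when it
  factors through the quotient of \<open>F\<close> by the subgroup they generate.
\<close>

section \<open>Homomorphisms and inclusion-exclusion sums in a free abelian group\<close>

lemma finprod_free_Abelian_group:
  assumes "finite I" "\<And>i. i \<in> I \<Longrightarrow> Poly_Mapping.keys (u i) \<subseteq> S"
  shows "finprod (free_Abelian_group S) u I = sum u I"
proof -
  interpret F: comm_group "free_Abelian_group S" by (rule abelian_free_Abelian_group)
  from assms show ?thesis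
    by (induction I rule: finite_induct) (auto simp: F.finprod_insert Pi_iff)
qed

text \<open>The elements on which two homomorphisms agree are closed under subtraction, and the
  generators \<open>frag_of x\<close> yield all of the free group by subtraction. This gives
  injectivity of \<open>representation\<close>.\<close>

lemma hom_free_Abelian_group_eqI:
  assumes "group B" "g \<in> hom (free_Abelian_group S) B" "h \<in> hom (free_Abelian_group S) B"
    and eq: "\<And>x. x \<in> S \<Longrightarrow> g (frag_of x) = h (frag_of x)"
    and c: "Poly_Mapping.keys c \<subseteq> S"
  shows "g c = h c"
proof -
  interpret g: group_hom "free_Abelian_group S" B g
    using assms by (simp add: group_hom_def group_hom_axioms_def)
  interpret h: group_hom "free_Abelian_group S" B h
    using assms by (simp add: group_hom_def group_hom_axioms_def)
  show ?thesis
  proof (rule free_Abelian_group_induct[OF c])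
    show "g 0 = h 0" using g.hom_one h.hom_one by simp
  next
    fix x y
    assume xy: "Poly_Mapping.keys x \<subseteq> S" "Poly_Mapping.keys y \<subseteq> S" "g x = h x" "g y = h y"
    have diff: "f (x - y) = f x \<otimes>\<^bsub>B\<^esub> inv\<^bsub>B\<^esub> f y"
      if "group_hom (free_Abelian_group S) B f" for f
      using xy group_hom.hom_mult[OF that, of x "- y"] group_hom.hom_inv[OF that, of y]
      by simp
    show "g (x - y) = h (x - y)"
      by (simp only: diff[OF g.group_hom_axioms] diff[OF h.group_hom_axioms] xy)
  qed (rule eq)
qed

text \<open>The bridge between two notations: \<open>measure_relations\<close> is written with the
  additive operations on formal sums, whereas \<open>incl_excl\<close> uses \<open>finprod\<close>
  and integer powers. Seeing the former as \<open>incl_excl\<close> of \<open>frag_of\<close> makes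
  \<open>incl_excl_hom\<close> applicable to the relations.\<close>

lemma incl_excl_free_Abelian_group:
  assumes L: "bounded_lattice L" and x: "x \<in> {1..k} \<rightarrow> carrier L"
  shows "incl_excl L (free_Abelian_group (carrier L)) k x frag_of =
    (\<Sum>s = 1..k. frag_cmul ((-1) ^ (s + 1))
      (\<Sum>I | I \<subseteq> {1..k} \<and> card I = s. frag_of (\<Sqinter>\<^bsub>L\<^esub> (x ` I))))"
proof -
  let ?F = "free_Abelian_group (carrier L)"
  interpret F: comm_group ?F by (rule abelian_free_Abelian_group)
  let ?J = "\<lambda>s. {I. I \<subseteq> {1..k} \<and> card I = s}"
  \<comment> \<open>As \<open>s\<close> starts at 1, each index set \<open>I\<close> is nonempty, so
    only meets of nonempty finite families occur.\<close>
  have cl: "\<Sqinter>\<^bsub>L\<^esub> (x ` I) \<in> carrier L" if "s \<in> {1..k}" "I \<in> ?J s" for s I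
    using that by (intro Inf_closed[OF L x]) auto
  have keys: "Poly_Mapping.keys (\<Sum>I\<in>?J s. frag_of (\<Sqinter>\<^bsub>L\<^esub> (x ` I))) \<subseteq> carrier L"
    if "s \<in> {1..k}" for s
    using sum_closed_free_Abelian_group[of "?J s" "\<lambda>I. frag_of (\<Sqinter>\<^bsub>L\<^esub> (x ` I))" "carrier L"]
      cl[OF that] by simp
  have inner: "finprod ?F (\<lambda>I. frag_of (\<Sqinter>\<^bsub>L\<^esub> (x ` I))) (?J s) [^]\<^bsub>?F\<^esub> ((-1 :: int) ^ (s + 1)) =
      frag_cmul ((-1) ^ (s + 1)) (\<Sum>I\<in>?J s. frag_of (\<Sqinter>\<^bsub>L\<^esub> (x ` I)))"
    if s: "s \<in> {1..k}" for s
    using cl[OF s] keys[OF s] by (subst finprod_free_Abelian_group) auto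
  have kc: "Poly_Mapping.keys (frag_cmul n (\<Sum>I\<in>?J s. frag_of (\<Sqinter>\<^bsub>L\<^esub> (x ` I)))) \<subseteq> carrier L"
    if "s \<in> {1..k}" for s n
    using keys[OF that] keys_cmul by (rule order_trans[rotated])
  have "incl_excl L ?F k x frag_of =
      finprod ?F (\<lambda>s. frag_cmul ((-1) ^ (s + 1)) (\<Sum>I\<in>?J s. frag_of (\<Sqinter>\<^bsub>L\<^esub> (x ` I)))) {1..k}"
    unfolding incl_excl_def
    by (rule F.finprod_cong') (use inner kc in auto)
  also have "\<dots> = (\<Sum>s = 1..k. frag_cmul ((-1) ^ (s + 1)) (\<Sum>I\<in>?J s. frag_of (\<Sqinter>\<^bsub>L\<^esub> (x ` I))))"
    by (rule finprod_free_Abelian_group) (use kc in auto)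
  finally show ?thesis .
qed

lemma incl_excl_closed:
  assumes L: "bounded_lattice L" and B: "comm_group B" and \<nu>: "\<nu> \<in> carrier L \<rightarrow> carrier B"
    and x: "x \<in> {1..k} \<rightarrow> carrier L"
  shows "incl_excl L B k x \<nu> \<in> carrier B"
proof -
  interpret B: comm_group B by fact
  have "\<Sqinter>\<^bsub>L\<^esub> (x ` I) \<in> carrier L" if "s \<in> {1..k}" "I \<subseteq> {1..k}" "card I = s" for s I
    using that by (intro Inf_closed[OF L x]) auto
  then show ?thesis
    unfolding incl_excl_def using \<nu> by (intro B.finprod_closed Pi_I B.int_pow_closed) blast
qed

section \<open>The measure relations, their quotient, and the kernel criterion\<close>

lemma measure_relations_eq:
  assumes "bounded_lattice L"
  shows "measure_relations L = {frag_of \<bottom>\<^bsub>L\<^esub>} \<union>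
    {frag_of (\<Squnion>\<^bsub>L\<^esub> (x ` {1..k})) - incl_excl L (free_Abelian_group (carrier L)) k x frag_of
      | (k::nat) x. 2 \<le> k \<and> x \<in> {1..k} \<rightarrow> carrier L}"
  unfolding measure_relations_def
  \<comment> \<open>\<open>rev_conj_cong\<close> makes the side condition that \<open>x\<close> maps
    into the carrier available while the relation itself is rewritten.\<close>
  by (intro arg_cong2[where f = "(\<union>)"] refl Collect_cong ex_cong1 rev_conj_cong)
    (simp only: incl_excl_free_Abelian_group[OF assms])

lemma measure_relations_subset:
  assumes L: "bounded_lattice L"
  shows "measure_relations L \<subseteq> carrier (free_Abelian_group (carrier L))"
proof -
  interpret L: bounded_lattice L by fact
  let ?F = "free_Abelian_group (carrier L)"
  interpret F: comm_group ?F by (rule abelian_free_Abelian_group)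
  have "frag_of (\<Squnion>\<^bsub>L\<^esub> (x ` {1..k})) - incl_excl L ?F k x frag_of \<in> carrier ?F"
    if "2 \<le> k" "x \<in> {1..k} \<rightarrow> carrier L" for k x
  proof -
    have "incl_excl L ?F k x frag_of \<in> carrier ?F"
      by (rule incl_excl_closed[OF L F.comm_group_axioms _ that(2)]) simp
    then show ?thesis
      using Sup_closed[OF L that(2,1)] by (auto dest!: keys_diff[THEN subsetD])
  qed
  then show ?thesis
    by (auto simp: measure_relations_eq[OF L] simp del: carrier_free_Abelian_group_iff)
qed

lemma subgroup_relation_subgroup:
  assumes "bounded_lattice L"
  shows "subgroup (relation_subgroup L) (free_Abelian_group (carrier L))"
  unfolding relation_subgroup_def
  by (rule group.generate_is_subgroup[OF group_free_Abelian_group measure_relations_subset[OF assms]])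

lemma normal_relation_subgroup:
  assumes "bounded_lattice L"
  shows "relation_subgroup L \<lhd> free_Abelian_group (carrier L)"
  by (rule comm_group.subgroup_imp_normal[OF abelian_free_Abelian_group
        subgroup_relation_subgroup[OF assms]])

lemma comm_group_universal_group:
  assumes "bounded_lattice L"
  shows "comm_group (universal_group L)"
  unfolding universal_group_def
  by (rule comm_group.abelian_FactGroup[OF abelian_free_Abelian_group
        subgroup_relation_subgroup[OF assms]])

text \<open>Homomorphisms commute with \<open>incl_excl\<close>, so each measure axiom for the
  restriction of \<open>h\<close> to generators says that \<open>h\<close> sends one element of
  \<open>measure_relations L\<close> to the identity. A kernel is a subgroup, so it contains these
  elements iff it contains what they generate. Both directions are needed: one shows that
  \<open>representation\<close> lands in measures, the other that every measure is hit.\<close>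

lemma is_measure_iff_relations_in_kernel:
  assumes L: "bounded_lattice L" and B: "comm_group B"
    and h: "h \<in> hom (free_Abelian_group (carrier L)) B"
  shows "is_measure L B (\<lambda>x\<in>carrier L. h (frag_of x)) \<longleftrightarrow>
    relation_subgroup L \<subseteq> kernel (free_Abelian_group (carrier L)) B h"
proof -
  interpret L: bounded_lattice L by fact
  let ?F = "free_Abelian_group (carrier L)" and ?\<nu> = "\<lambda>x\<in>carrier L. h (frag_of x)"
  interpret F: comm_group ?F by (rule abelian_free_Abelian_group)
  interpret B: comm_group B by fact
  interpret h: group_hom ?F B h by unfold_locales fact
  \<comment> \<open>Here \<open>frag_of\<close> takes the place of the function on the lattice, with
    values in the free group, and \<open>h\<close> is the homomorphism applied to it.\<close>
  have ie: "incl_excl L B k x ?\<nu> = h (incl_excl L ?F k x frag_of)"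
    if "x \<in> {1..k} \<rightarrow> carrier L" for k x
    by (rule incl_excl_hom[OF L F.comm_group_axioms B h _ that]) auto
  have rel: "?\<nu> (\<Squnion>\<^bsub>L\<^esub> (x ` {1..k})) = incl_excl L B k x ?\<nu> \<longleftrightarrow>
      h (frag_of (\<Squnion>\<^bsub>L\<^esub> (x ` {1..k})) - incl_excl L ?F k x frag_of) = \<one>\<^bsub>B\<^esub>"
    if k: "2 \<le> k" and x: "x \<in> {1..k} \<rightarrow> carrier L" for k x
  proof -
    define a where "a = frag_of (\<Squnion>\<^bsub>L\<^esub> (x ` {1..k}))"
    define b where "b = incl_excl L ?F k x frag_of"
    have a: "a \<in> carrier ?F"
      using Sup_closed[OF L x k] by (simp add: a_def)
    have b: "b \<in> carrier ?F"
      unfolding b_def by (rule incl_excl_closed[OF L F.comm_group_axioms _ x]) simp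
    have "a - b = a \<otimes>\<^bsub>?F\<^esub> inv\<^bsub>?F\<^esub> b" using b by simp
    then have "h (a - b) = h a \<otimes>\<^bsub>B\<^esub> inv\<^bsub>B\<^esub> h b"
      using a b by (metis F.inv_closed h.hom_inv h.hom_mult)
    moreover have "h a = h b \<longleftrightarrow> h a \<otimes>\<^bsub>B\<^esub> inv\<^bsub>B\<^esub> h b = \<one>\<^bsub>B\<^esub>"
      using h.hom_closed[OF a] h.hom_closed[OF b] by (metis B.inv_equality B.inv_inv B.inv_closed B.r_inv)
    ultimately show ?thesis
      using Sup_closed[OF L x k] by (simp add: ie[OF x] a_def b_def)
  qed
  have "?\<nu> \<in> carrier L \<rightarrow>\<^sub>E carrier B" by auto
  then have "is_measure L B ?\<nu> \<longleftrightarrow> h (frag_of \<bottom>\<^bsub>L\<^esub>) = \<one>\<^bsub>B\<^esub> \<and>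
      (\<forall>k\<ge>2. \<forall>x \<in> {1..k} \<rightarrow> carrier L.
        h (frag_of (\<Squnion>\<^bsub>L\<^esub> (x ` {1..k})) - incl_excl L ?F k x frag_of) = \<one>\<^bsub>B\<^esub>)"
    unfolding is_measure_iff using rel by simp
  also have "\<dots> \<longleftrightarrow> (\<forall>r\<in>measure_relations L. h r = \<one>\<^bsub>B\<^esub>)"
    unfolding measure_relations_eq[OF L] by blast
  also have "\<dots> \<longleftrightarrow> measure_relations L \<subseteq> kernel ?F B h"
    using measure_relations_subset[OF L] by (auto simp: kernel_def simp del: carrier_free_Abelian_group_iff)
  also have "\<dots> \<longleftrightarrow> relation_subgroup L \<subseteq> kernel ?F B h"
    unfolding relation_subgroup_def
    using F.generate_subgroup_incl[OF _ h.subgroup_kernel] generate.incl[of _ "measure_relations L" ?F]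
    by blast
  finally show ?thesis .
qed

section \<open>The natural isomorphism \<open>representation\<close>\<close>

lemma representation_coset_hom:
  "representation L h = (\<lambda>x\<in>carrier L.
     h (relation_subgroup L #>\<^bsub>free_Abelian_group (carrier L)\<^esub> frag_of x))"
  by (auto simp: representation_def compose_def universal_measure_def)

text \<open>Pulling \<open>h\<close> back along the projection reduces questions about the quotient
  to the free group, where generators decide.\<close>

lemma hom_comp_coset:
  assumes L: "bounded_lattice L" and h: "h \<in> hom (universal_group L) B"
  shows "(\<lambda>c. h (relation_subgroup L #>\<^bsub>free_Abelian_group (carrier L)\<^esub> c))
    \<in> hom (free_Abelian_group (carrier L)) B"
  using hom_compose[OF normal.r_coset_hom_Mod[OF normal_relation_subgroup[OF L]]] h
  by (force simp: universal_group_def comp_def)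

lemma is_measure_representation:
  assumes L: "bounded_lattice L" and B: "comm_group B" and h: "h \<in> hom (universal_group L) B"
  shows "is_measure L B (representation L h)"
proof -
  let ?F = "free_Abelian_group (carrier L)"
  interpret N: subgroup "relation_subgroup L" ?F by (rule subgroup_relation_subgroup[OF L])
  \<comment> \<open>The subgroup itself is the identity of the quotient, and it is also the coset of
    each of its elements. Hence the pullback of \<open>h\<close> is trivial on it.\<close>
  have "h (relation_subgroup L) = \<one>\<^bsub>B\<^esub>"
    using hom_one[OF h] comm_group_universal_group[OF L] B
    by (simp add: universal_group_def comm_group_def)
  then have "relation_subgroup L \<subseteq> kernel ?F B (\<lambda>c. h (relation_subgroup L #>\<^bsub>?F\<^esub> c))"
    using N.subset N.rcos_const[OF group_free_Abelian_group]
    by (auto simp: kernel_def simp del: carrier_free_Abelian_group_iff)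
  then show ?thesis
    unfolding representation_coset_hom
    using is_measure_iff_relations_in_kernel[OF L B hom_comp_coset[OF L h]] by simp
qed

lemma representation_iso:
  assumes L: "bounded_lattice L" and B: "comm_group B"
  shows "representation L \<in> iso (Hom_group (universal_group L) B) (measure_group L B)"
proof -
  let ?F = "free_Abelian_group (carrier L)" and ?U = "universal_group L"
  let ?q = "\<lambda>c. relation_subgroup L #>\<^bsub>?F\<^esub> c"
  interpret B: comm_group B by fact
  have carrier_U: "carrier ?U = ?q ` carrier ?F"
    by (simp add: universal_group_def carrier_FactGroup)
  have q_in: "?q (frag_of x) \<in> carrier ?U" if "x \<in> carrier L" for x
    using that by (auto simp: carrier_U)
  have hom: "representation L \<in> hom (Hom_group ?U B) (measure_group L B)"
  proof (rule homI)
    fix h assume "h \<in> carrier (Hom_group ?U B)"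
    then show "representation L h \<in> carrier (measure_group L B)"
      using is_measure_representation[OF L B] by (simp add: Hom_group_def measure_group_def)
  qed (auto simp: Hom_group_def measure_group_def representation_coset_hom fun_eq_iff q_in)
  have inj: "inj_on (representation L) (carrier (Hom_group ?U B))"
  proof (rule inj_onI)
    fix g h assume "g \<in> carrier (Hom_group ?U B)" "h \<in> carrier (Hom_group ?U B)"
      and eq: "representation L g = representation L h"
    then have g: "g \<in> hom ?U B" "g \<in> extensional (carrier ?U)"
      and h: "h \<in> hom ?U B" "h \<in> extensional (carrier ?U)"
      by (auto simp: Hom_group_def)
    \<comment> \<open>The pullbacks of \<open>g\<close> and \<open>h\<close> agree on generators by
      \<open>eq\<close>, hence on the whole free group; every element of the quotient is some
      \<open>?q c\<close>.\<close>
    have "g (?q c) = h (?q c)" if "c \<in> carrier ?F" for c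
    proof (rule hom_free_Abelian_group_eqI[OF B.group_axioms
          hom_comp_coset[OF L g(1)] hom_comp_coset[OF L h(1)]])
      fix x assume "x \<in> carrier L"
      then show "g (?q (frag_of x)) = h (?q (frag_of x))"
        using fun_cong[OF eq, of x] by (simp add: representation_coset_hom)
    qed (use that in simp)
    then show "g = h"
      by (intro extensionalityI[OF g(2) h(2)]) (auto simp: carrier_U)
  qed
  have surj: "\<nu> \<in> representation L ` carrier (Hom_group ?U B)" if \<nu>: "is_measure L B \<nu>" for \<nu>
  proof -
    have ext: "\<nu> \<in> carrier L \<rightarrow>\<^sub>E carrier B" using \<nu> by (simp add: is_measure_iff)
    \<comment> \<open>Surjectivity uses two universal properties in turn: that of the free group
      extends the measure to \<open>h\<close>, and that of the quotient factors \<open>h\<close> as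
      \<open>g\<close> after the projection.\<close>
    then obtain h where h: "h \<in> hom ?F B" "\<And>x. x \<in> carrier L \<Longrightarrow> h (frag_of x) = \<nu> x"
      using B.free_Abelian_group_universal[of \<nu> "carrier L"] by blast
    have \<nu>_eq: "\<nu> = (\<lambda>x\<in>carrier L. h (frag_of x))"
      using ext h(2) by (auto simp: fun_eq_iff PiE_def extensional_def)
    interpret h: group_hom ?F B h
      using h(1) B.group_axioms by (simp add: group_hom_def group_hom_axioms_def)
    have "relation_subgroup L \<subseteq> kernel ?F B h"
      using \<nu> is_measure_iff_relations_in_kernel[OF L B h(1)] by (simp add: \<nu>_eq)
    then obtain g where g: "g \<in> hom ?U B" "\<And>c. c \<in> carrier ?F \<Longrightarrow> g (?q c) = h c"
      using h.FactGroup_universal_kernel[OF normal_relation_subgroup[OF L]]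
      unfolding universal_group_def by blast
    interpret U: comm_group ?U by (rule comm_group_universal_group[OF L])
    \<comment> \<open>The factor \<open>g\<close> may take any values off the carrier, while members
      of \<open>Hom_group\<close> are extensional.\<close>
    have "restrict g (carrier ?U) \<in> carrier (Hom_group ?U B)"
      using g(1) by (auto simp: Hom_group_def hom_def)
    moreover have "representation L (restrict g (carrier ?U)) = \<nu>"
      using q_in g(2) by (auto simp: representation_coset_hom \<nu>_eq)
    ultimately show ?thesis by blast
  qed
  have "representation L ` carrier (Hom_group ?U B) = carrier (measure_group L B)"
    using hom surj unfolding hom_def by (auto simp: measure_group_def)
  with hom inj show ?thesis
    by (simp add: iso_def bij_betw_def)
qed

text \<open>Postcomposition with \<open>f\<close> commutes with precomposition by
  \<open>universal_measure\<close>. The one point to check is that the cosets of generators lie in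
  the carrier of the quotient, where the restriction built into \<open>Hom_map\<close> has no
  effect.\<close>

lemma representation_natural:
  shows "representation L (Hom_map (universal_group L) f h) = measure_map L f (representation L h)"
  by (auto simp: representation_coset_hom Hom_map_def measure_map_def compose_def
      universal_group_def carrier_FactGroup)

theorem proposition6:
  fixes L :: "'a gorder"
  assumes "bounded_lattice L"
  shows "comm_group (universal_group L) \<and>
    (\<forall>B :: 'b monoid. comm_group B \<longrightarrow>
       representation L \<in> iso (Hom_group (universal_group L) B) (measure_group L B)) \<and>
    (\<forall>(B :: 'b monoid) (B' :: 'd monoid) f.
       comm_group B \<and> comm_group B' \<and> f \<in> hom B B' \<longrightarrow>
       (\<forall>h \<in> carrier (Hom_group (universal_group L) B).
          representation L (Hom_map (universal_group L) f h) =
          measure_map L f (representation L h)))"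
  using comm_group_universal_group[OF assms] representation_iso[OF assms]
    representation_natural by blast

end
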